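(* Let $A,S$ be finite sets, $\Gamma=A\times A\times S\times S$, and let $P=(P(a,b|s,t))\in C_q(\Gamma)$ be a synchronous quantum correlation. Then the smallest local dimension in which $P$ can be realized, that is, $\min\{d\in\mathbb{N}:P\in C_q^d(\Gamma)\}$, equals the completely positive semidefinite rank $\text{cpsd-rank}(M_P)$ of the matrix $M_P$ indexed by $S\times A$ with entries $(M_P)_{(s,a),(t,b)}=P(a,b|s,t)$.
   Context: For $d\in\mathbb{N}$, $C_q^d(\Gamma)$ (quantum correlations realizable in the tensor model in local dimension $d$) is the set of $P\in\mathbb{R}^\Gamma$ of the form $P(a,b|s,t)=\psi^*(E_s^a\otimes F_t^b)\psi$, where $\psi\in\mathbb{C}^d\otimes\mathbb{C}^d$ is a unit vector and, for all $s,t\in S$, $\{E_s^a\}_{a\in A}$ and $\{F_t^b\}_{b\in A}$ are families of $d\times d$ Hermitian positive semidefinite matrices each summing to the identity. $C_q(\Gamma)=\bigcup_{d\in\mathbb{N}}C_q^d(\Gamma)$ is the set of quantum correlations. $P$ is synchronous if $P(a,b|s,s)=0$ for all $s\in S$ and all $a\ne b$ in $A$. A matrix $M\in\mathbb{R}^{n\times n}$ is completely positive semidefinite if there exist $d\in\mathbb{N}$ and Hermitian positive semidefinite matrices $X_1,\dots,X_n\in\mathbb{C}^{d\times d}$ with $M=(\operatorname{Tr}(X_iX_j))_{i,j}$. The smallest such $d$ is its completely positive semidefinite rank, denoted $\text{cpsd-rank}(M)$. *)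

theory Defs
  imports "Jordan_Normal_Form.Schur_Decomposition"
begin

(* The inner product "v \<bullet>c w" is conjugate-linear in w, so "(X *\<^sub>v v) \<bullet>c v" is v* X v. *)
definition psd_mat :: "nat \<Rightarrow> complex mat \<Rightarrow> bool" where
  "psd_mat d X \<longleftrightarrow>
     X \<in> carrier_mat d d \<and> mat_adjoint X = X \<and>
     (\<forall>v \<in> carrier_vec d. 0 \<le> (X *\<^sub>v v) \<bullet>c v)"

definition mat_trace :: "'a::comm_monoid_add mat \<Rightarrow> 'a" where
  "mat_trace X = (\<Sum>i<dim_row X. X $$ (i, i))"

definition kron_mat :: "'a::times mat \<Rightarrow> 'a mat \<Rightarrow> 'a mat" where
  "kron_mat X Y =
     mat (dim_row X * dim_row Y) (dim_col X * dim_col Y)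
       (\<lambda>(i, j). X $$ (i div dim_row Y, j div dim_col Y) * Y $$ (i mod dim_row Y, j mod dim_col Y))"

definition is_povm :: "nat \<Rightarrow> 'a set \<Rightarrow> ('a \<Rightarrow> complex mat) \<Rightarrow> bool" where
  "is_povm d A E \<longleftrightarrow>
     (\<forall>a\<in>A. psd_mat d (E a)) \<and>
     mat d d (\<lambda>(i, j). \<Sum>a\<in>A. E a $$ (i, j)) = 1\<^sub>m d"

(* "P a b s t" is P(a,b|s,t).  Only the values of P on A x A x S x S are constrained; the
   function represents its restriction to that set.  No d = 0 case arises, as there is no
   unit vector in dimension 0. *)
definition quantum_corr_dim ::
  "'a set \<Rightarrow> 's set \<Rightarrow> nat \<Rightarrow> ('a \<Rightarrow> 'a \<Rightarrow> 's \<Rightarrow> 's \<Rightarrow> real) set" where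
  "quantum_corr_dim A S d =
     {P. \<exists>\<psi> E F.
        \<psi> \<in> carrier_vec (d * d) \<and> \<psi> \<bullet>c \<psi> = 1 \<and>
        (\<forall>s\<in>S. is_povm d A (E s)) \<and> (\<forall>t\<in>S. is_povm d A (F t)) \<and>
        (\<forall>a\<in>A. \<forall>b\<in>A. \<forall>s\<in>S. \<forall>t\<in>S.
           complex_of_real (P a b s t) = (kron_mat (E s a) (F t b) *\<^sub>v \<psi>) \<bullet>c \<psi>)}"

definition quantum_corr ::
  "'a set \<Rightarrow> 's set \<Rightarrow> ('a \<Rightarrow> 'a \<Rightarrow> 's \<Rightarrow> 's \<Rightarrow> real) set" where
  "quantum_corr A S = (\<Union>d. quantum_corr_dim A S d)"

definition synchronous ::
  "'a set \<Rightarrow> 's set \<Rightarrow> ('a \<Rightarrow> 'a \<Rightarrow> 's \<Rightarrow> 's \<Rightarrow> real) \<Rightarrow> bool" where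
  "synchronous A S P \<longleftrightarrow> (\<forall>s\<in>S. \<forall>a\<in>A. \<forall>b\<in>A. a \<noteq> b \<longrightarrow> P a b s s = 0)"

(* A real matrix with rows and columns indexed by a finite set I is a function
   "M :: 'i => 'i => real", of which only the values on I x I matter.  The size d of the
   factors is a positive integer; this is relevant only when I is empty or M is zero on I x I. *)
definition cpsd_factorizable :: "'i set \<Rightarrow> ('i \<Rightarrow> 'i \<Rightarrow> real) \<Rightarrow> nat \<Rightarrow> bool" where
  "cpsd_factorizable I M d \<longleftrightarrow>
     0 < d \<and>
     (\<exists>X. (\<forall>i\<in>I. psd_mat d (X i)) \<and>
          (\<forall>i\<in>I. \<forall>j\<in>I. complex_of_real (M i j) = mat_trace (X i * X j)))"

definition completely_psd :: "'i set \<Rightarrow> ('i \<Rightarrow> 'i \<Rightarrow> real) \<Rightarrow> bool" where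
  "completely_psd I M \<longleftrightarrow> (\<exists>d. cpsd_factorizable I M d)"

(* Meaningful only if "completely_psd I M". *)
definition cpsd_rank :: "'i set \<Rightarrow> ('i \<Rightarrow> 'i \<Rightarrow> real) \<Rightarrow> nat" where
  "cpsd_rank I M = (LEAST d. cpsd_factorizable I M d)"

definition corr_matrix ::
  "('a \<Rightarrow> 'a \<Rightarrow> 's \<Rightarrow> 's \<Rightarrow> real) \<Rightarrow> ('s \<times> 'a) \<Rightarrow> ('s \<times> 'a) \<Rightarrow> real" where
  "corr_matrix P = (\<lambda>(s, a) (t, b). P a b s t)"

end

(* In each dimension d separately, a synchronous quantum correlation P is realizable in local
   dimension d iff its matrix has a cpsd factorization by d x d matrices; no minimality of d is
   needed.

   Write the state as a d x d matrix M, so that P(a,b|s,t) = Tr(E_s^a H_t^b) with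
   H_t^b = M (F_t^b)^T M*.  Synchronicity says Tr(E_s^a H_s^b) = 0 for a different from b, hence
   E_s^a H_s^b = 0.  Summing over b, and then over a, gives E_s^a rho = H_s^a for rho = M M*, so
   E_s^a commutes with rho and the matrices rho^(1/4) E_s^a rho^(1/4) form a cpsd factorization.

   Conversely, let X_s^a form a cpsd factorization.  As Tr(Y_s Y_t) = 1 for all s, t, where
   Y_s = sum_a X_s^a, all Y_s are one matrix K.  Take K as the state, and as measurements
   K^(-1/2) X_s^a K^(-1/2) (pseudo-inverse) completed to a POVM by adding 1/|A| times the
   projection onto ker K, which the state annihilates; the second party uses the transposes. *)
theory Submission
  imports Defs "Jordan_Normal_Form.Spectral_Radius"
begin

section \<open>Adjoints and the spectral theorem for Hermitian matrices\<close>

text \<open>An entry of a product as an explicit sum, the form that exchange of summation needs. The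
  simp rule \<open>index_mult_mat(1)\<close> would produce a scalar product of a row and a column
  instead, so it is deleted in many of the calls below.\<close>

lemma index_mult_mat_sum:
  assumes "A \<in> carrier_mat n m" "B \<in> carrier_mat m k" "i < n" "j < k"
  shows "(A * B) $$ (i, j) = (\<Sum>l<m. A $$ (i, l) * B $$ (l, j))"
  using assms by (simp add: scalar_prod_def atLeast0LessThan)

lemma dim_mat_adjoint[simp]:
  "dim_row (mat_adjoint A) = dim_col A" "dim_col (mat_adjoint A) = dim_row A"
  by (simp_all add: mat_adjoint_def)

lemma mat_adjoint_carrier[simp]:
  "A \<in> carrier_mat n m \<Longrightarrow> mat_adjoint A \<in> carrier_mat m n"
  by (rule carrier_matI) auto

lemma index_mat_adjoint[simp]:
  "i < dim_col A \<Longrightarrow> j < dim_row A \<Longrightarrow> mat_adjoint A $$ (i, j) = conjugate (A $$ (j, i))"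
  by (simp add: mat_adjoint_def mat_of_rows_def)

lemma mat_adjoint_adjoint[simp]: "mat_adjoint (mat_adjoint A) = A"
  by (rule eq_matI) simp_all

lemma mat_adjoint_mult:
  assumes "A \<in> carrier_mat n m" "B \<in> carrier_mat m k"
  shows "mat_adjoint (A * B) = mat_adjoint B * mat_adjoint A"
  using assms
  by (intro eq_matI)
     (auto simp: index_mult_mat_sum[OF assms] sum_conjugate conjugate_dist_mul mult.commute
       index_mult_mat_sum[OF mat_adjoint_carrier[OF assms(2)] mat_adjoint_carrier[OF assms(1)]]
       simp del: index_mult_mat(1))

lemma mat_adjoint_one[simp]: "mat_adjoint (1\<^sub>m n) = (1\<^sub>m n :: complex mat)"
  by (rule eq_matI) simp_all

lemma mat_trace_mult:
  assumes "A \<in> carrier_mat n m" "B \<in> carrier_mat m n"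
  shows "mat_trace (A * B) = (\<Sum>i<n. \<Sum>j<m. A $$ (i, j) * B $$ (j, i))"
  using assms by (simp add: mat_trace_def index_mult_mat_sum[OF assms] del: index_mult_mat(1))

lemma mat_trace_mult_comm:
  fixes A B :: "'a::comm_semiring_0 mat"
  assumes "A \<in> carrier_mat n m" "B \<in> carrier_mat m n"
  shows "mat_trace (A * B) = mat_trace (B * A)"
  unfolding mat_trace_mult[OF assms] mat_trace_mult[OF assms(2,1)]
  using sum.swap[of "\<lambda>i j. A $$ (i, j) * B $$ (j, i)" "{..<m}" "{..<n}"]
  by (simp add: mult.commute)

lemma conjugate_sprod_mult_mat_vec:
  fixes A :: "complex mat"
  assumes "A \<in> carrier_mat n m" "v \<in> carrier_vec m" "w \<in> carrier_vec n"
  shows "(A *\<^sub>v v) \<bullet>c w = v \<bullet>c (mat_adjoint A *\<^sub>v w)"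
proof -
  have "(A *\<^sub>v v) \<bullet>c w = (\<Sum>i<n. \<Sum>j<m. A $$ (i, j) * v $ j * cnj (w $ i))"
    using assms by (simp add: scalar_prod_def sum_distrib_right atLeast0LessThan)
  also have "\<dots> = (\<Sum>j<m. \<Sum>i<n. v $ j * (A $$ (i, j) * cnj (w $ i)))"
    by (subst sum.swap) (simp add: mult_ac)
  also have "\<dots> = v \<bullet>c (mat_adjoint A *\<^sub>v w)"
    using assms by (simp add: scalar_prod_def sum_distrib_left atLeast0LessThan)
  finally show ?thesis .
qed

section \<open>Unitary diagonalization of Hermitian matrices\<close>

text \<open>Extend \<open>v\<close> to a basis, orthogonalize by Gram-Schmidt and normalize; the
  resulting vectors are the columns of \<open>W\<close>.\<close>

lemma unitary_completion:
  fixes v :: "complex vec"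
  assumes v: "v \<in> carrier_vec n" and v0: "v \<noteq> 0\<^sub>v n"
  shows "\<exists>W \<in> carrier_mat n n. \<exists>c. mat_adjoint W * W = 1\<^sub>m n \<and> col W 0 = c \<cdot>\<^sub>v v"
proof -
  interpret cof_vec_space n "TYPE(complex)" .
  define ws where "ws = gram_schmidt n (basis_completion v)"
  note b = basis_completion[OF v v0]
  note gs = gram_schmidt_result[OF b(2,4,5) ws_def]
  have len: "length ws = n" using gs b by simp
  have n: "0 < n" using v v0 by (cases n) auto
  \<comment> \<open>Gram-Schmidt leaves the first vector of the list unchanged, so the first column
    of \<open>W\<close> stays on the line through \<open>v\<close>.\<close>
  have hd: "ws ! 0 = v"
  proof -
    have "hd ws = v"
      using gram_schmidt_hd[OF v] by (simp add: ws_def basis_completion_def Let_def)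
    then show ?thesis using len n by (cases ws) auto
  qed
  define r where "r i = sqrt (Re (ws ! i \<bullet>c ws ! i))" for i
  define W where "W = mat n n (\<lambda>(i, j). ws ! j $ i / complex_of_real (r j))"
  have W: "W \<in> carrier_mat n n" by (simp add: W_def)
  have ws: "ws ! i \<in> carrier_vec n" if "i < n" for i
    using gs(3) len that by auto
  have pos: "ws ! i \<bullet>c ws ! i = complex_of_real (r i * r i)" "r i \<noteq> 0" if "i < n" for i
  proof -
    have "0 \<le> ws ! i \<bullet>c ws ! i" by (rule conjugate_square_ge_0_vec)
    moreover have "ws ! i \<bullet>c ws ! i \<noteq> 0"
      using corthogonalD[OF gs(2), of i i] len that by simp
    ultimately show "ws ! i \<bullet>c ws ! i = complex_of_real (r i * r i)" "r i \<noteq> 0"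
      by (auto simp: r_def less_eq_complex_def complex_eq_iff)
  qed
  have "mat_adjoint W * W = 1\<^sub>m n"
  proof (rule eq_matI)
    fix i j assume "i < dim_row (1\<^sub>m n :: complex mat)" "j < dim_col (1\<^sub>m n :: complex mat)"
    then have i: "i < n" and j: "j < n" by simp_all
    have "(mat_adjoint W * W) $$ (i, j) = (ws ! j \<bullet>c ws ! i) / (r i * r j)"
      using i j ws[OF i] ws[OF j] W
      by (simp add: index_mult_mat_sum[of _ n n _ n] W_def scalar_prod_def sum_divide_distrib
          atLeast0LessThan mult.commute)
    also have "\<dots> = 1\<^sub>m n $$ (i, j)"
      using corthogonalD[OF gs(2), of j i] len i j pos[of i] by auto
    finally show "(mat_adjoint W * W) $$ (i, j) = 1\<^sub>m n $$ (i, j)" .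
  qed (use W in auto)
  moreover have "col W 0 = (1 / complex_of_real (r 0)) \<cdot>\<^sub>v v"
    using v n hd by (intro eq_vecI) (auto simp: W_def)
  ultimately show ?thesis using W by blast
qed

lemma mult_block_diag:
  assumes "A \<in> carrier_mat m m" "A' \<in> carrier_mat m m" "B \<in> carrier_mat n n" "B' \<in> carrier_mat n n"
  shows "four_block_mat A (0\<^sub>m m n) (0\<^sub>m n m) B * four_block_mat A' (0\<^sub>m m n) (0\<^sub>m n m) B' =
    four_block_mat (A * A') (0\<^sub>m m n) (0\<^sub>m n m) (B * B')"
proof -
  have "A * A' \<in> carrier_mat m m" "B * B' \<in> carrier_mat n n" using assms by auto
  then show ?thesis
    using assms by (subst mult_four_block_mat[of _ m m _ n _ n _ _ m _ n]) auto
qed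

text \<open>Deflation by induction on \<open>n\<close>: a unitary whose first column lies on an
  eigenline splits off a block of size 1. Hermiticity clears the first row along with the first
  column, so the induction hypothesis applies to the remaining block.\<close>

lemma hermitian_diagonalization:
  fixes A :: "complex mat"
  assumes "A \<in> carrier_mat n n" "mat_adjoint A = A"
  shows "\<exists>U \<in> carrier_mat n n. mat_adjoint U * U = 1\<^sub>m n \<and> diagonal_mat (mat_adjoint U * A * U)"
  using assms
proof (induction n arbitrary: A)
  case 0
  then show ?case by (intro bexI[of _ "1\<^sub>m 0"]) (auto simp: diagonal_mat_def)
next
  case (Suc n A)
  note A = Suc.prems(1)
  note [simp] = assoc_mult_mat[of _ "Suc n" "Suc n" _ "Suc n" _ "Suc n"]
    mult_carrier_mat[of _ "Suc n" "Suc n" _ "Suc n"]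
  obtain e v where ev: "eigenvector A v e"
    using spectrum_non_empty[OF A] by (auto simp: spectrum_def eigenvalue_def)
  then have v: "v \<in> carrier_vec (Suc n)" "v \<noteq> 0\<^sub>v (Suc n)" and Av: "A *\<^sub>v v = e \<cdot>\<^sub>v v"
    using A by (auto simp: eigenvector_def)
  obtain W c where W: "W \<in> carrier_mat (Suc n) (Suc n)" and WW: "mat_adjoint W * W = 1\<^sub>m (Suc n)"
    and col: "col W 0 = c \<cdot>\<^sub>v v"
    using unitary_completion[OF v] by blast
  define B where "B = mat_adjoint W * A * W"
  have B: "B \<in> carrier_mat (Suc n) (Suc n)" using A W by (simp add: B_def)
  have herm: "mat_adjoint B = B"
    using A W Suc.prems(2)
    by (simp add: B_def mat_adjoint_mult[of _ "Suc n" "Suc n" _ "Suc n"])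
  have c0: "col W 0 \<in> carrier_vec (Suc n)" using v by (simp add: col)
  \<comment> \<open>The first column of \<open>W\<close> is an eigenvector and \<open>W\<close> is
    unitary, so the first column of \<open>B\<close> comes out as \<open>e\<close> times the first
    unit vector.\<close>
  have "col B 0 = mat_adjoint W *\<^sub>v (A *\<^sub>v col W 0)"
  proof -
    have AW: "A * W \<in> carrier_mat (Suc n) (Suc n)" by (rule mult_carrier_mat[OF A W])
    have "B = mat_adjoint W * (A * W)" using A W by (simp add: B_def)
    then show ?thesis
      using col_mult2[OF mat_adjoint_carrier[OF W] AW, of 0] col_mult2[OF A W, of 0] by simp
  qed
  also have "A *\<^sub>v col W 0 = e \<cdot>\<^sub>v col W 0"
    using A v by (simp add: col mult_mat_vec[of _ "Suc n" "Suc n"] Av smult_smult_assoc mult.commute)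
  also have "mat_adjoint W *\<^sub>v (e \<cdot>\<^sub>v col W 0) = e \<cdot>\<^sub>v col (mat_adjoint W * W) 0"
    using W c0 by (simp add: mult_mat_vec[of _ "Suc n" "Suc n" "col W 0"]
        col_mult2[of _ "Suc n" "Suc n" _ "Suc n"])
  finally have col0: "col B 0 = e \<cdot>\<^sub>v col (1\<^sub>m (Suc n)) 0" by (simp add: WW)
  have B0: "B $$ (i, 0) = (if i = 0 then e else 0)" if "i < Suc n" for i
    using arg_cong[OF col0, of "\<lambda>x. x $ i"] B that by auto
  have B1: "B $$ (0, j) = 0" if "j < Suc n" "j \<noteq> 0" for j
    using B0[OF that(1)] that(2) B that(1) arg_cong[OF herm, of "\<lambda>x. x $$ (0, j)"] by simp
  define C where "C = mat n n (\<lambda>(i, j). B $$ (Suc i, Suc j))"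
  have C: "C \<in> carrier_mat n n" by (simp add: C_def)
  have "mat_adjoint C = C"
  proof (rule eq_matI)
    fix i j assume "i < dim_row C" "j < dim_col C"
    then show "mat_adjoint C $$ (i, j) = C $$ (i, j)"
      using B arg_cong[OF herm, of "\<lambda>x. x $$ (Suc i, Suc j)"] by (simp add: C_def)
  qed (simp_all add: C_def)
  from Suc.IH[OF C this] obtain V where V: "V \<in> carrier_mat n n" "mat_adjoint V * V = 1\<^sub>m n"
    and diag: "diagonal_mat (mat_adjoint V * C * V)" by blast
  define E where "E = mat 1 1 (\<lambda>_. e)"
  \<comment> \<open>\<open>T\<close> lets the smaller unitary \<open>V\<close> act on the lower
    block only; the diagonalizing unitary will be \<open>W * T\<close>.\<close>
  define T where "T = four_block_mat (1\<^sub>m 1) (0\<^sub>m 1 n) (0\<^sub>m n 1) V"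
  have T': "mat_adjoint T = four_block_mat (1\<^sub>m 1) (0\<^sub>m 1 n) (0\<^sub>m n 1) (mat_adjoint V)"
    using V by (intro eq_matI) (auto simp: T_def)
  have B': "B = four_block_mat E (0\<^sub>m 1 n) (0\<^sub>m n 1) C"
    using B by (intro eq_matI) (auto simp: E_def C_def B0 B1)
  have T: "T \<in> carrier_mat (Suc n) (Suc n)" using four_block_carrier_mat[of "1\<^sub>m 1" 1 1 V n n] V(1) by (simp add: T_def)
  have E: "E \<in> carrier_mat 1 1" by (simp add: E_def)
  note block = mult_block_diag[of _ 1 _ _ n]
  have TT: "mat_adjoint T * T = 1\<^sub>m (Suc n)"
    unfolding T' unfolding T_def using V by (subst block) auto
  have TBT: "mat_adjoint T * B * T = four_block_mat E (0\<^sub>m 1 n) (0\<^sub>m n 1) (mat_adjoint V * C * V)"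
    unfolding T' B' unfolding T_def using V E C
    by (simp add: block mult_carrier_mat[of _ n n _ n] del: One_nat_def)
  have "diagonal_mat (mat_adjoint T * B * T)"
    unfolding TBT diagonal_mat_def
  proof (intro allI impI)
    fix i j
    let ?M = "four_block_mat E (0\<^sub>m 1 n) (0\<^sub>m n 1) (mat_adjoint V * C * V)"
    assume "i < dim_row ?M" "j < dim_col ?M" "i \<noteq> j"
    then show "?M $$ (i, j) = 0"
      using diag V(1) E unfolding diagonal_mat_def by (simp del: index_mult_mat(1))
  qed
  moreover have "mat_adjoint T * B * T = mat_adjoint (W * T) * A * (W * T)"
    using W A T by (simp add: B_def mat_adjoint_mult[OF W T])
  moreover have "mat_adjoint (W * T) * (W * T) = mat_adjoint T * ((mat_adjoint W * W) * T)"
    using W A T by (simp add: mat_adjoint_mult[OF W T])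
  moreover have "\<dots> = 1\<^sub>m (Suc n)"
    using T by (simp add: WW TT)
  ultimately have "W * T \<in> carrier_mat (Suc n) (Suc n) \<and> mat_adjoint (W * T) * (W * T) = 1\<^sub>m (Suc n)
      \<and> diagonal_mat (mat_adjoint (W * T) * A * (W * T))"
    using W T by simp
  then show ?case by blast
qed

section \<open>Positive semidefinite matrices\<close>

lemma psd_mat_carrier: "psd_mat d X \<Longrightarrow> X \<in> carrier_mat d d"
  and psd_mat_adjoint: "psd_mat d X \<Longrightarrow> mat_adjoint X = X"
  by (simp_all add: psd_mat_def)

lemma psd_mat_index_conjugate:
  assumes "psd_mat d X" "i < d" "j < d"
  shows "X $$ (i, j) = cnj (X $$ (j, i))"
  using index_mat_adjoint[of i X j] psd_mat_adjoint[OF assms(1)] psd_mat_carrier[OF assms(1)] assms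
  by simp

text \<open>The quadratic form of the new matrix at \<open>v\<close> is that of \<open>X\<close> at
  \<open>C v\<close>. The matrix \<open>C\<close> may be rectangular.\<close>

lemma psd_mat_congruence:
  assumes X: "psd_mat d X" and C: "C \<in> carrier_mat d m"
  shows "psd_mat m (mat_adjoint C * X * C)"
  unfolding psd_mat_def
proof (intro conjI ballI)
  note X' = psd_mat_carrier[OF X]
  have C': "mat_adjoint C \<in> carrier_mat m d" using C by simp
  have AX: "mat_adjoint C * X \<in> carrier_mat m d" using C' X' by simp
  show "mat_adjoint C * X * C \<in> carrier_mat m m" using AX C by simp
  show "mat_adjoint (mat_adjoint C * X * C) = mat_adjoint C * X * C"
    unfolding mat_adjoint_mult[OF AX C] mat_adjoint_mult[OF C' X'] psd_mat_adjoint[OF X]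
    using assoc_mult_mat[OF C' X' C] by simp
  fix v :: "complex vec" assume v: "v \<in> carrier_vec m"
  have Cv: "C *\<^sub>v v \<in> carrier_vec d" using C v by simp
  have XCv: "X *\<^sub>v (C *\<^sub>v v) \<in> carrier_vec d" using X' Cv by simp
  have "(mat_adjoint C * X * C *\<^sub>v v) \<bullet>c v = (mat_adjoint C *\<^sub>v (X *\<^sub>v (C *\<^sub>v v))) \<bullet>c v"
    using assoc_mult_mat_vec[OF AX C v] assoc_mult_mat_vec[OF C' X' Cv] by simp
  also have "\<dots> = (X *\<^sub>v (C *\<^sub>v v)) \<bullet>c (C *\<^sub>v v)"
    using conjugate_sprod_mult_mat_vec[OF C' XCv v] by simp
  finally show "0 \<le> (mat_adjoint C * X * C *\<^sub>v v) \<bullet>c v"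
    using X Cv by (simp add: psd_mat_def)
qed

lemma psd_mat_one: "psd_mat d (1\<^sub>m d)"
  by (auto simp: psd_mat_def conjugate_square_ge_0_vec)

lemma psd_mat_adjoint_mult:
  assumes "B \<in> carrier_mat m d"
  shows "psd_mat d (mat_adjoint B * B)"
  using psd_mat_congruence[OF psd_mat_one assms] assms
  by (simp add: right_mult_one_mat[of _ d m])

lemma psd_mat_index_diag_ge_0:
  assumes X: "psd_mat d X" and i: "i < d"
  shows "0 \<le> X $$ (i, i)"
proof -
  have "(X *\<^sub>v unit_vec d i) \<bullet>c unit_vec d i = X $$ (i, i)"
  proof -
    have "conjugate (unit_vec d i :: complex vec) = unit_vec d i"
      by (rule eq_vecI) (auto simp: unit_vec_def)
    then show ?thesis using psd_mat_carrier[OF X] i by simp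
  qed
  moreover have "0 \<le> (X *\<^sub>v unit_vec d i) \<bullet>c unit_vec d i"
    using X by (simp add: psd_mat_def)
  ultimately show ?thesis by simp
qed

section \<open>Real diagonal matrices and the spectral form of positive semidefinite
  matrices\<close>

definition real_diag_mat :: "nat \<Rightarrow> (nat \<Rightarrow> real) \<Rightarrow> complex mat" where
  "real_diag_mat d r = mat d d (\<lambda>(i, j). if i = j then complex_of_real (r i) else 0)"

lemma real_diag_mat_carrier[simp]: "real_diag_mat d r \<in> carrier_mat d d"
  by (simp add: real_diag_mat_def)

lemma dim_real_diag_mat[simp]:
  "dim_row (real_diag_mat d r) = d" "dim_col (real_diag_mat d r) = d"
  by (simp_all add: real_diag_mat_def)

lemma index_real_diag_mat[simp]:
  "i < d \<Longrightarrow> j < d \<Longrightarrow> real_diag_mat d r $$ (i, j) = (if i = j then complex_of_real (r i) else 0)"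
  by (simp add: real_diag_mat_def)

lemma mat_adjoint_real_diag_mat[simp]: "mat_adjoint (real_diag_mat d r) = real_diag_mat d r"
  by (rule eq_matI) auto

lemma index_real_diag_mult_left:
  assumes "A \<in> carrier_mat d m" "i < d" "j < m"
  shows "(real_diag_mat d r * A) $$ (i, j) = complex_of_real (r i) * A $$ (i, j)"
  using assms
  by (simp add: index_mult_mat_sum[OF real_diag_mat_carrier assms(1)] if_distrib[of "\<lambda>x. x * _"]
      sum.delta cong: if_cong del: index_mult_mat(1))

lemma index_real_diag_mult_right:
  assumes "A \<in> carrier_mat m d" "i < m" "j < d"
  shows "(A * real_diag_mat d r) $$ (i, j) = A $$ (i, j) * complex_of_real (r j)"
  using assms
  by (simp add: index_mult_mat_sum[OF assms(1) real_diag_mat_carrier] if_distrib[of "\<lambda>x. _ * x"]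
      sum.delta cong: if_cong del: index_mult_mat(1))

lemma real_diag_mat_mult: "real_diag_mat d r * real_diag_mat d q = real_diag_mat d (\<lambda>i. r i * q i)"
  by (rule eq_matI) (auto simp: index_real_diag_mult_left[of _ d d] simp del: index_mult_mat(1))

lemma psd_mat_real_diag_mat:
  assumes "\<And>i. 0 \<le> r i"
  shows "psd_mat d (real_diag_mat d r)"
  using psd_mat_adjoint_mult[of "real_diag_mat d (\<lambda>i. sqrt (r i))" d d] assms
  by (simp add: real_diag_mat_mult)

text \<open>Unitary conjugation is a congruence, so the diagonal matrix it produces is again
  positive semidefinite and its diagonal entries are nonnegative reals.\<close>

lemma psd_mat_diagonalization:
  assumes X: "psd_mat d X"
  obtains U r where "U \<in> carrier_mat d d" "mat_adjoint U * U = 1\<^sub>m d" "U * mat_adjoint U = 1\<^sub>m d"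
    "\<forall>i. 0 \<le> r i" "mat_adjoint U * X * U = real_diag_mat d r"
proof -
  obtain U where U: "U \<in> carrier_mat d d" "mat_adjoint U * U = 1\<^sub>m d"
    and diag: "diagonal_mat (mat_adjoint U * X * U)"
    using hermitian_diagonalization[OF psd_mat_carrier[OF X] psd_mat_adjoint[OF X]] by blast
  define Y where "Y = mat_adjoint U * X * U"
  have Y: "psd_mat d Y" unfolding Y_def by (rule psd_mat_congruence[OF X U(1)])
  \<comment> \<open>The value 0 for indices from \<open>d\<close> on makes the eigenvalue function
    nonnegative on all of \<open>nat\<close>, as the conclusion asks.\<close>
  have "Y = real_diag_mat d (\<lambda>i. if i < d then Re (Y $$ (i, i)) else 0)"
  proof (rule eq_matI)
    fix i j assume "i < dim_row (real_diag_mat d (\<lambda>i. if i < d then Re (Y $$ (i, i)) else 0))"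
      "j < dim_col (real_diag_mat d (\<lambda>i. if i < d then Re (Y $$ (i, i)) else 0))"
    then have ij: "i < d" "j < d" by simp_all
    have "Y $$ (i, j) = 0" if "i \<noteq> j"
      using diag that ij psd_mat_carrier[OF Y] unfolding Y_def[symmetric] diagonal_mat_def by simp
    moreover have "Y $$ (i, i) = complex_of_real (Re (Y $$ (i, i)))"
      using psd_mat_index_diag_ge_0[OF Y ij(1)] by (simp add: less_eq_complex_def complex_eq_iff)
    ultimately show "Y $$ (i, j) = real_diag_mat d (\<lambda>i. if i < d then Re (Y $$ (i, i)) else 0) $$ (i, j)"
      using ij by (cases "i = j") simp_all
  qed (use psd_mat_carrier[OF Y] in auto)
  then have D: "mat_adjoint U * X * U = real_diag_mat d (\<lambda>i. if i < d then Re (Y $$ (i, i)) else 0)"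
    unfolding Y_def[symmetric] .
  have r: "\<forall>i. 0 \<le> (if i < d then Re (Y $$ (i, i)) else 0)"
    using psd_mat_index_diag_ge_0[OF Y] by (auto simp: less_eq_complex_def)
  have "U * mat_adjoint U = 1\<^sub>m d"
    using mat_mult_left_right_inverse[OF _ U(1) U(2)] U(1) by simp
  then show ?thesis by (rule that[OF U _ r D])
qed

lemma conj_unitary_inverse:
  assumes "U \<in> carrier_mat d d" "mat_adjoint U * U = 1\<^sub>m d" "U * mat_adjoint U = 1\<^sub>m d" "X \<in> carrier_mat d d"
  shows "U * (mat_adjoint U * X * U) * mat_adjoint U = X"
proof -
  have "U * (mat_adjoint U * X * U) * mat_adjoint U = (U * mat_adjoint U) * X * (U * mat_adjoint U)"
    using assms(1,4) by (simp add: assoc_mult_mat[of _ d d _ d _ d] mult_carrier_mat[of _ d d _ d])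
  then show ?thesis using assms by simp
qed

text \<open>Take the square root of the diagonal form: \<open>B\<close> is that root times the
  adjoint of \<open>U\<close>.\<close>

lemma psd_mat_factorization:
  assumes X: "psd_mat d X"
  obtains B where "B \<in> carrier_mat d d" "X = mat_adjoint B * B"
proof -
  obtain U r where U: "U \<in> carrier_mat d d" "mat_adjoint U * U = 1\<^sub>m d" "U * mat_adjoint U = 1\<^sub>m d"
    and r: "\<forall>i. 0 \<le> r i" and D: "mat_adjoint U * X * U = real_diag_mat d r"
    by (rule psd_mat_diagonalization[OF X])
  define B where "B = real_diag_mat d (\<lambda>i. sqrt (r i)) * mat_adjoint U"
  have S: "real_diag_mat d (\<lambda>i. sqrt (r i)) * real_diag_mat d (\<lambda>i. sqrt (r i)) = mat_adjoint U * X * U"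
    using r by (simp add: real_diag_mat_mult D)
  have B: "B \<in> carrier_mat d d" using U(1) by (simp add: B_def mult_carrier_mat[of _ d d _ d])
  have "mat_adjoint B * B =
      U * (real_diag_mat d (\<lambda>i. sqrt (r i)) * real_diag_mat d (\<lambda>i. sqrt (r i))) * mat_adjoint U"
    using U(1) by (simp add: B_def mat_adjoint_mult[of _ d d _ d] assoc_mult_mat[of _ d d _ d _ d]
        mult_carrier_mat[of _ d d _ d] del: real_diag_mat_mult)
  also have "\<dots> = X" unfolding S by (rule conj_unitary_inverse[OF U psd_mat_carrier[OF X]])
  finally show ?thesis using that B by simp
qed

text \<open>The trace is the squared Frobenius norm of \<open>B\<close>.\<close>

lemma mat_trace_adjoint_mult_eq_0:
  assumes B: "(B :: complex mat) \<in> carrier_mat n m" and tr: "mat_trace (mat_adjoint B * B) = 0"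
  shows "B = 0\<^sub>m n m"
proof (rule eq_matI)
  have "complex_of_real (\<Sum>j<m. \<Sum>i<n. (cmod (B $$ (i, j)))\<^sup>2) = mat_trace (mat_adjoint B * B)"
    using B by (simp add: mat_trace_mult[of _ m n] complex_norm_square[symmetric] mult.commute)
  then have "(\<Sum>j<m. \<Sum>i<n. (cmod (B $$ (i, j)))\<^sup>2) = 0" by (simp only: tr of_real_eq_0_iff)
  then have *: "B $$ (i, j) = 0" if "i < n" "j < m" for i j
    using that by (simp add: sum_nonneg_eq_0_iff sum_nonneg)
  fix i j assume "i < dim_row (0\<^sub>m n m :: complex mat)" "j < dim_col (0\<^sub>m n m :: complex mat)"
  then show "B $$ (i, j) = 0\<^sub>m n m $$ (i, j)" by (simp add: *)
qed (use B in auto)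

text \<open>For factors \<open>B\<close> of \<open>X\<close> and \<open>C\<close> of
  \<open>Y\<close>, cyclicity turns the trace into the squared Frobenius norm of
  \<open>B * mat_adjoint C\<close>, and this product sits inside \<open>X * Y\<close>.\<close>

lemma psd_mat_trace_mult_eq_0:
  assumes X: "psd_mat d X" and Y: "psd_mat d Y" and tr: "mat_trace (X * Y) = 0"
  shows "X * Y = 0\<^sub>m d d"
proof -
  obtain B C where B: "B \<in> carrier_mat d d" "X = mat_adjoint B * B"
    and C: "C \<in> carrier_mat d d" "Y = mat_adjoint C * C"
    using psd_mat_factorization[OF X] psd_mat_factorization[OF Y] by metis
  note assoc = assoc_mult_mat[of _ d d _ d _ d] mult_carrier_mat[of _ d d _ d]
  have XY: "X * Y = (mat_adjoint B * (B * mat_adjoint C)) * C"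
    using B C by (simp add: assoc)
  have "mat_trace (X * Y) = mat_trace (C * (mat_adjoint B * (B * mat_adjoint C)))"
    unfolding XY using B(1) C(1) by (intro mat_trace_mult_comm[of _ d d]) (auto simp: assoc)
  also have "C * (mat_adjoint B * (B * mat_adjoint C)) = mat_adjoint (B * mat_adjoint C) * (B * mat_adjoint C)"
    using B(1) C(1) by (simp add: assoc mat_adjoint_mult[of _ d d _ d])
  finally have "B * mat_adjoint C = 0\<^sub>m d d"
    using B(1) C(1) tr by (intro mat_trace_adjoint_mult_eq_0) (auto simp: assoc)
  then show ?thesis using B(1) C(1) by (simp add: XY)
qed

text \<open>A diagonal entry is the squared norm of a column of the factor \<open>B\<close>. If it
  vanishes, so does that column, and with it a whole row and column of \<open>X\<close>.\<close>

lemma psd_mat_index_eq_0: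
  assumes X: "psd_mat d X" and "X $$ (i, i) = 0" and ij: "i < d" "j < d"
  shows "X $$ (i, j) = 0" "X $$ (j, i) = 0"
proof -
  obtain B where B: "B \<in> carrier_mat d d" "X = mat_adjoint B * B"
    using psd_mat_factorization[OF X] .
  have "complex_of_real (\<Sum>l<d. (cmod (B $$ (l, i)))\<^sup>2) = X $$ (i, i)"
    using B ij by (simp add: index_mult_mat_sum[of _ d d _ d] complex_norm_square[symmetric] mult.commute
      del: index_mult_mat(1))
  then have "(\<Sum>l<d. (cmod (B $$ (l, i)))\<^sup>2) = 0" using assms(2) by (simp only: of_real_eq_0_iff)
  then have *: "B $$ (l, i) = 0" if "l < d" for l
    using that by (simp add: sum_nonneg_eq_0_iff)
  then show "X $$ (j, i) = 0"
    using B ij by (simp add: index_mult_mat_sum[of _ d d _ d] del: index_mult_mat(1))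
  then show "X $$ (i, j) = 0" using psd_mat_index_conjugate[OF X ij] by simp
qed

text \<open>The entrywise conjugate \<open>C\<close> of a factor of \<open>X\<close> is a factor of
  the transpose.\<close>

lemma psd_mat_transpose:
  assumes X: "psd_mat d X"
  shows "psd_mat d (transpose_mat X)"
proof -
  obtain B where B: "B \<in> carrier_mat d d" "X = mat_adjoint B * B"
    using psd_mat_factorization[OF X] .
  define C where "C = mat d d (\<lambda>(i, j). cnj (B $$ (i, j)))"
  have C: "C \<in> carrier_mat d d" by (simp add: C_def)
  have "transpose_mat X = mat_adjoint C * C"
  proof (rule eq_matI)
    fix i j assume "i < dim_row (mat_adjoint C * C)" "j < dim_col (mat_adjoint C * C)"
    then have ij: "i < d" "j < d" using C by simp_all
    have "X $$ (j, i) = (\<Sum>l<d. cnj (B $$ (l, j)) * B $$ (l, i))"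
      using B ij by (simp add: index_mult_mat_sum[of _ d d _ d] del: index_mult_mat(1))
    moreover have "(mat_adjoint C * C) $$ (i, j) = (\<Sum>l<d. B $$ (l, i) * cnj (B $$ (l, j)))"
      using C ij
      by (simp add: index_mult_mat_sum[of _ d d _ d] del: index_mult_mat(1)) (simp add: C_def)
    ultimately show "transpose_mat X $$ (i, j) = (mat_adjoint C * C) $$ (i, j)"
      using ij psd_mat_carrier[OF X] by (simp add: mult.commute del: index_mult_mat(1))
  qed (use C psd_mat_carrier[OF X] in auto)
  then show ?thesis using psd_mat_adjoint_mult[OF C] by simp
qed

lemma psd_mat_add:
  assumes X: "psd_mat d X" and Y: "psd_mat d Y"
  shows "psd_mat d (X + Y)"
  unfolding psd_mat_def
proof (intro conjI ballI)
  note XY = psd_mat_carrier[OF X] psd_mat_carrier[OF Y]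
  show "X + Y \<in> carrier_mat d d" using XY by simp
  show "mat_adjoint (X + Y) = X + Y"
  proof (rule eq_matI)
    fix i j assume "i < dim_row (X + Y)" "j < dim_col (X + Y)"
    then have ij: "i < d" "j < d" using XY by simp_all
    show "mat_adjoint (X + Y) $$ (i, j) = (X + Y) $$ (i, j)"
      using ij XY
      by (simp add: psd_mat_index_conjugate[OF X, of i j] psd_mat_index_conjugate[OF Y, of i j])
  qed (use XY in auto)
  fix v :: "complex vec" assume v: "v \<in> carrier_vec d"
  have "((X + Y) *\<^sub>v v) \<bullet>c v = (X *\<^sub>v v) \<bullet>c v + (Y *\<^sub>v v) \<bullet>c v"
    using XY v by (simp add: add_mult_distrib_mat_vec[of _ d d] add_scalar_prod_distrib[of _ d])
  then show "0 \<le> ((X + Y) *\<^sub>v v) \<bullet>c v"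
    using X Y v by (simp add: psd_mat_def)
qed

section \<open>Sums of families of matrices\<close>

text \<open>The same entrywise form as in \<open>is_povm\<close>; with the size given explicitly,
  the empty sum is the zero matrix of size \<open>d\<close>.\<close>

definition mat_sum :: "nat \<Rightarrow> 'a set \<Rightarrow> ('a \<Rightarrow> complex mat) \<Rightarrow> complex mat" where
  "mat_sum d A X = mat d d (\<lambda>(i, j). \<Sum>a\<in>A. X a $$ (i, j))"

lemma mat_sum_carrier[simp]: "mat_sum d A X \<in> carrier_mat d d"
  by (simp add: mat_sum_def)

lemma dim_mat_sum[simp]: "dim_row (mat_sum d A X) = d" "dim_col (mat_sum d A X) = d"
  by (simp_all add: mat_sum_def)

lemma index_mat_sum[simp]: "i < d \<Longrightarrow> j < d \<Longrightarrow> mat_sum d A X $$ (i, j) = (\<Sum>a\<in>A. X a $$ (i, j))"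
  by (simp add: mat_sum_def)

lemma mat_sum_mult_left:
  assumes "B \<in> carrier_mat d d" "\<And>a. a \<in> A \<Longrightarrow> X a \<in> carrier_mat d d"
  shows "mat_sum d A (\<lambda>a. B * X a) = B * mat_sum d A X"
proof (rule eq_matI)
  fix i j assume "i < dim_row (B * mat_sum d A X)" "j < dim_col (B * mat_sum d A X)"
  then have ij: "i < d" "j < d" using assms by auto
  have "mat_sum d A (\<lambda>a. B * X a) $$ (i, j) = (\<Sum>a\<in>A. \<Sum>l<d. B $$ (i, l) * X a $$ (l, j))"
    using ij assms by (simp add: index_mult_mat_sum[of _ d d _ d] del: index_mult_mat(1))
  also have "\<dots> = (B * mat_sum d A X) $$ (i, j)"
    using ij assms
    by (subst sum.swap) (simp add: index_mult_mat_sum[of _ d d _ d] sum_distrib_left del: index_mult_mat(1))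
  finally show "mat_sum d A (\<lambda>a. B * X a) $$ (i, j) = (B * mat_sum d A X) $$ (i, j)" .
qed (use assms in auto)

lemma mat_sum_mult_right:
  assumes "B \<in> carrier_mat d d" "\<And>a. a \<in> A \<Longrightarrow> X a \<in> carrier_mat d d"
  shows "mat_sum d A (\<lambda>a. X a * B) = mat_sum d A X * B"
proof (rule eq_matI)
  fix i j assume "i < dim_row (mat_sum d A X * B)" "j < dim_col (mat_sum d A X * B)"
  then have ij: "i < d" "j < d" using assms by auto
  have "mat_sum d A (\<lambda>a. X a * B) $$ (i, j) = (\<Sum>a\<in>A. \<Sum>l<d. X a $$ (i, l) * B $$ (l, j))"
    using ij assms by (simp add: index_mult_mat_sum[of _ d d _ d] del: index_mult_mat(1))
  also have "\<dots> = (mat_sum d A X * B) $$ (i, j)"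
    using ij assms
    by (subst sum.swap) (simp add: index_mult_mat_sum[of _ d d _ d] sum_distrib_right del: index_mult_mat(1))
  finally show "mat_sum d A (\<lambda>a. X a * B) $$ (i, j) = (mat_sum d A X * B) $$ (i, j)" .
qed (use assms in auto)

lemma mat_trace_mat_sum:
  assumes "\<And>a. a \<in> A \<Longrightarrow> X a \<in> carrier_mat d d"
  shows "mat_trace (mat_sum d A X) = (\<Sum>a\<in>A. mat_trace (X a))"
  using assms by (simp add: mat_trace_def carrier_matD(1)[OF assms] sum.swap[of _ _ A])

lemma mat_sum_singleton:
  assumes "finite A" "a \<in> A" "X a \<in> carrier_mat d d" "\<And>b. b \<in> A \<Longrightarrow> b \<noteq> a \<Longrightarrow> X b = 0\<^sub>m d d"
  shows "mat_sum d A X = X a"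
proof (rule eq_matI)
  fix i j assume "i < dim_row (X a)" "j < dim_col (X a)"
  then have ij: "i < d" "j < d" using assms by auto
  have "(\<Sum>b\<in>A. X b $$ (i, j)) = (\<Sum>b\<in>{a}. X b $$ (i, j))"
    using assms ij by (intro sum.mono_neutral_right) auto
  then show "mat_sum d A X $$ (i, j) = X a $$ (i, j)" using ij by simp
qed (use assms in auto)

lemma psd_mat_mat_sum:
  assumes "finite A" "\<And>a. a \<in> A \<Longrightarrow> psd_mat d (X a)"
  shows "psd_mat d (mat_sum d A X)"
  using assms
proof (induction A)
  case empty
  have "mat_sum d {} X = real_diag_mat d (\<lambda>_. 0)" by (rule eq_matI) auto
  then show ?case using psd_mat_real_diag_mat[of "\<lambda>_. 0" d] by simp
next
  case (insert a A)
  have "mat_sum d (insert a A) X = X a + mat_sum d A X"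
    using insert.hyps insert.prems[of a] psd_mat_carrier[of d "X a"] by (intro eq_matI) auto
  then show ?case using psd_mat_add insert by simp
qed

lemma is_povm_iff: "is_povm d A E \<longleftrightarrow> (\<forall>a\<in>A. psd_mat d (E a)) \<and> mat_sum d A E = 1\<^sub>m d"
  by (simp add: is_povm_def mat_sum_def)

section \<open>Correlations in matrix form\<close>

text \<open>Division with remainder by \<open>n\<close> is a bijection from the indices below
  \<open>m * n\<close> to pairs; it unfolds the index of a tensor product.\<close>

lemma sum_div_mod:
  fixes f :: "nat \<Rightarrow> nat \<Rightarrow> 'b::comm_monoid_add"
  shows "(\<Sum>p<m * n. f (p div n) (p mod n)) = (\<Sum>i<m. \<Sum>k<n. f i k)"
  unfolding sum.cartesian_product
proof (rule sum.reindex_bij_witness[of _ "\<lambda>(i, k). i * n + k" "\<lambda>p. (p div n, p mod n)"])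
  fix p assume "p \<in> {..<m * n}"
  then show "(p div n, p mod n) \<in> {..<m} \<times> {..<n}"
    by (cases "n = 0") (auto simp: less_mult_imp_div_less)
next
  fix x assume x: "x \<in> {..<m} \<times> {..<n}"
  then obtain i k where ik: "x = (i, k)" "i < m" "k < n" by auto
  then have "Suc i * n \<le> m * n" by (intro mult_right_mono) auto
  then show "(case x of (i, k) \<Rightarrow> i * n + k) \<in> {..<m * n}" using ik by simp
qed auto

text \<open>A vector in the tensor square of \<open>\<complex>\<^sup>d\<close> is read as the \<open>d \<times> d\<close> matrix of its coefficients.\<close>

lemma kron_mat_quadratic_form:
  fixes X Y M :: "complex mat"
  assumes X: "X \<in> carrier_mat d d" and Y: "Y \<in> carrier_mat d d" and M: "M \<in> carrier_mat d d"
    and \<psi>: "\<psi> = vec (d * d) (\<lambda>p. M $$ (p div d, p mod d))"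
  shows "(kron_mat X Y *\<^sub>v \<psi>) \<bullet>c \<psi> = mat_trace (X * (M * (transpose_mat Y * mat_adjoint M)))"
proof -
  have "(kron_mat X Y *\<^sub>v \<psi>) \<bullet>c \<psi> = (\<Sum>p<d * d. (\<Sum>q<d * d.
      X $$ (p div d, q div d) * Y $$ (p mod d, q mod d) * M $$ (q div d, q mod d))
      * cnj (M $$ (p div d, p mod d)))"
    using X Y by (simp add: \<psi> kron_mat_def scalar_prod_def atLeast0LessThan)
  also have "\<dots> = (\<Sum>p<d * d. (\<Sum>j<d. \<Sum>l<d.
      X $$ (p div d, j) * Y $$ (p mod d, l) * M $$ (j, l)) * cnj (M $$ (p div d, p mod d)))"
    by (subst sum_div_mod[of "\<lambda>j l. X $$ (_ div d, j) * Y $$ (_ mod d, l) * M $$ (j, l)" d d]) (rule refl)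
  also have "\<dots> = (\<Sum>i<d. \<Sum>k<d. (\<Sum>j<d. \<Sum>l<d.
      X $$ (i, j) * Y $$ (k, l) * M $$ (j, l)) * cnj (M $$ (i, k)))"
    by (rule sum_div_mod)
  also have "\<dots> = (\<Sum>i<d. \<Sum>k<d. \<Sum>j<d. \<Sum>l<d.
      X $$ (i, j) * (M $$ (j, l) * (Y $$ (k, l) * cnj (M $$ (i, k)))))"
    by (simp add: sum_distrib_left sum_distrib_right mult_ac)
  \<comment> \<open>With \<open>k\<close> innermost the indices run along the product
    \<open>X\<close>, \<open>M\<close>, transpose of \<open>Y\<close>, adjoint of \<open>M\<close>,
    closing up at \<open>i\<close> to a trace.\<close>
  also have "\<dots> = (\<Sum>i<d. \<Sum>j<d. \<Sum>l<d. \<Sum>k<d.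
      X $$ (i, j) * (M $$ (j, l) * (Y $$ (k, l) * cnj (M $$ (i, k)))))"
  proof (rule sum.cong[OF refl])
    fix i
    let ?f = "\<lambda>k j l. X $$ (i, j) * (M $$ (j, l) * (Y $$ (k, l) * cnj (M $$ (i, k))))"
    have "(\<Sum>k<d. \<Sum>j<d. \<Sum>l<d. ?f k j l) = (\<Sum>j<d. \<Sum>k<d. \<Sum>l<d. ?f k j l)"
      by (rule sum.swap)
    also have "\<dots> = (\<Sum>j<d. \<Sum>l<d. \<Sum>k<d. ?f k j l)"
      by (intro sum.cong refl sum.swap)
    finally show "(\<Sum>k<d. \<Sum>j<d. \<Sum>l<d. ?f k j l) = (\<Sum>j<d. \<Sum>l<d. \<Sum>k<d. ?f k j l)" .
  qed
  also have "\<dots> = mat_trace (X * (M * (transpose_mat Y * mat_adjoint M)))"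
  proof -
    have YM: "transpose_mat Y * mat_adjoint M \<in> carrier_mat d d"
      using Y M by (intro mult_carrier_mat[of _ d d]) auto
    have MYM: "M * (transpose_mat Y * mat_adjoint M) \<in> carrier_mat d d"
      by (rule mult_carrier_mat[OF M YM])
    have "(M * (transpose_mat Y * mat_adjoint M)) $$ (j, i) =
        (\<Sum>l<d. M $$ (j, l) * (\<Sum>k<d. Y $$ (k, l) * cnj (M $$ (i, k))))" if "i < d" "j < d" for i j
      using that Y M
      by (simp add: index_mult_mat_sum[OF M YM] index_mult_mat_sum[of _ d d _ d] del: index_mult_mat(1))
    then show ?thesis
      by (simp add: mat_trace_mult[OF X MYM] sum_distrib_left)
  qed
  finally show ?thesis .
qed

lemma is_povm_transpose:
  assumes "is_povm d A E"
  shows "is_povm d A (\<lambda>a. transpose_mat (E a))"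
proof -
  have E: "psd_mat d (E a)" if "a \<in> A" for a using assms that by (simp add: is_povm_iff)
  have "mat_sum d A (\<lambda>a. transpose_mat (E a)) = transpose_mat (mat_sum d A E)"
    by (intro eq_matI) (simp_all add: carrier_matD[OF psd_mat_carrier[OF E]])
  then show ?thesis using assms E by (simp add: is_povm_iff psd_mat_transpose)
qed

text \<open>The working form of realizability: the state becomes a matrix, and the transposes of the
  second party's operators are absorbed into \<open>G\<close>, since transposition preserves
  POVMs.\<close>

lemma quantum_corr_dim_iff_mat:
  "P \<in> quantum_corr_dim A S d \<longleftrightarrow>
    (\<exists>M E G. M \<in> carrier_mat d d \<and> mat_trace (M * mat_adjoint M) = 1 \<and>
      (\<forall>s\<in>S. is_povm d A (E s)) \<and> (\<forall>t\<in>S. is_povm d A (G t)) \<and>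
      (\<forall>a\<in>A. \<forall>b\<in>A. \<forall>s\<in>S. \<forall>t\<in>S.
         complex_of_real (P a b s t) = mat_trace (E s a * (M * (G t b * mat_adjoint M)))))"
  (is "?L \<longleftrightarrow> ?R")
proof -
  have norm: "vec (d * d) (\<lambda>p. M $$ (p div d, p mod d)) \<bullet>c vec (d * d) (\<lambda>p. M $$ (p div d, p mod d))
      = mat_trace (M * mat_adjoint M)" if "M \<in> carrier_mat d d" for M :: "complex mat"
    using that sum_div_mod[of "\<lambda>i k. M $$ (i, k) * cnj (M $$ (i, k))" d d]
    by (simp add: scalar_prod_def atLeast0LessThan mat_trace_mult[of _ d d])
  have carrier: "E s a \<in> carrier_mat d d" if "\<forall>s\<in>S. is_povm d A (E s)" "s \<in> S" "a \<in> A"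
    for E :: "'b \<Rightarrow> 'a \<Rightarrow> complex mat" and s a
    using that by (auto simp: is_povm_iff psd_mat_def)
  show ?thesis
  proof
    assume ?L
    then obtain \<psi> E F where \<psi>: "\<psi> \<in> carrier_vec (d * d)" "\<psi> \<bullet>c \<psi> = 1"
      and E: "\<forall>s\<in>S. is_povm d A (E s)" and F: "\<forall>t\<in>S. is_povm d A (F t)"
      and P: "\<forall>a\<in>A. \<forall>b\<in>A. \<forall>s\<in>S. \<forall>t\<in>S.
           complex_of_real (P a b s t) = (kron_mat (E s a) (F t b) *\<^sub>v \<psi>) \<bullet>c \<psi>"
      unfolding quantum_corr_dim_def by blast
    define M where "M = mat d d (\<lambda>(i, k). \<psi> $ (i * d + k))"
    have M: "M \<in> carrier_mat d d" by (simp add: M_def)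
    \<comment> \<open>For \<open>d = 0\<close> there is no such \<open>p\<close>, hence the case
      split for the remainder.\<close>
    have dm: "p div d < d" "p mod d < d" if "p < d * d" for p
      using that by (auto simp: less_mult_imp_div_less) (cases "d = 0"; simp)
    have \<psi>M: "\<psi> = vec (d * d) (\<lambda>p. M $$ (p div d, p mod d))"
      using \<psi>(1) by (intro eq_vecI) (auto simp: M_def dm)
    have "mat_trace (M * mat_adjoint M) = 1" using norm[OF M] \<psi>(2) \<psi>M by simp
    moreover have "\<forall>t\<in>S. is_povm d A (\<lambda>b. transpose_mat (F t b))"
      using F by (auto intro: is_povm_transpose)
    moreover have "\<forall>a\<in>A. \<forall>b\<in>A. \<forall>s\<in>S. \<forall>t\<in>S. complex_of_real (P a b s t)
        = mat_trace (E s a * (M * (transpose_mat (F t b) * mat_adjoint M)))"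
    proof (intro ballI)
      fix a b s t assume "a \<in> A" "b \<in> A" "s \<in> S" "t \<in> S"
      then show "complex_of_real (P a b s t)
          = mat_trace (E s a * (M * (transpose_mat (F t b) * mat_adjoint M)))"
        using P kron_mat_quadratic_form[OF carrier[OF E] carrier[OF F] M \<psi>M, of s a t b] by metis
    qed
    ultimately show ?R
      using M E by (intro exI[of _ M] exI[of _ E] exI[of _ "\<lambda>t b. transpose_mat (F t b)"]) (intro conjI)
  next
    assume ?R
    then obtain M E G where M: "M \<in> carrier_mat d d" "mat_trace (M * mat_adjoint M) = 1"
      and E: "\<forall>s\<in>S. is_povm d A (E s)" and G: "\<forall>t\<in>S. is_povm d A (G t)"
      and P: "\<forall>a\<in>A. \<forall>b\<in>A. \<forall>s\<in>S. \<forall>t\<in>S.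
         complex_of_real (P a b s t) = mat_trace (E s a * (M * (G t b * mat_adjoint M)))"
      by blast
    define \<psi> where "\<psi> = vec (d * d) (\<lambda>p. M $$ (p div d, p mod d))"
    have "\<psi> \<in> carrier_vec (d * d)" by (simp add: \<psi>_def)
    moreover have "\<psi> \<bullet>c \<psi> = 1" using norm[OF M(1)] M(2) by (simp add: \<psi>_def)
    moreover have "\<forall>t\<in>S. is_povm d A (\<lambda>b. transpose_mat (G t b))"
      using G by (auto intro: is_povm_transpose)
    moreover have "\<forall>a\<in>A. \<forall>b\<in>A. \<forall>s\<in>S. \<forall>t\<in>S. complex_of_real (P a b s t)
        = (kron_mat (E s a) (transpose_mat (G t b)) *\<^sub>v \<psi>) \<bullet>c \<psi>"
    proof (intro ballI)
      fix a b s t assume *: "a \<in> A" "b \<in> A" "s \<in> S" "t \<in> S"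
      have "transpose_mat (G t b) \<in> carrier_mat d d" using carrier[OF G *(4,2)] by simp
      from kron_mat_quadratic_form[OF carrier[OF E *(3,1)] this M(1) \<psi>_def]
      show "complex_of_real (P a b s t)
          = (kron_mat (E s a) (transpose_mat (G t b)) *\<^sub>v \<psi>) \<bullet>c \<psi>"
        using P * by (simp only: transpose_transpose)
    qed
    ultimately show ?L
      unfolding quantum_corr_dim_def mem_Collect_eq using E
      by (intro exI[of _ \<psi>] exI[of _ E] exI[of _ "\<lambda>t b. transpose_mat (G t b)"]) (intro conjI)
  qed
qed

lemma mat_trace_mult_mat_sum:
  assumes B: "B \<in> carrier_mat d d" and X: "\<And>a. a \<in> A \<Longrightarrow> X a \<in> carrier_mat d d"
  shows "mat_trace (B * mat_sum d A X) = (\<Sum>a\<in>A. mat_trace (B * X a))"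
    and "mat_trace (mat_sum d A X * B) = (\<Sum>a\<in>A. mat_trace (X a * B))"
proof -
  have "B * X a \<in> carrier_mat d d" "X a * B \<in> carrier_mat d d" if "a \<in> A" for a
    using mult_carrier_mat[OF B X[OF that]] mult_carrier_mat[OF X[OF that] B] by simp_all
  then show "mat_trace (B * mat_sum d A X) = (\<Sum>a\<in>A. mat_trace (B * X a))"
    "mat_trace (mat_sum d A X * B) = (\<Sum>a\<in>A. mat_trace (X a * B))"
    using mat_sum_mult_left[of B d A X] mat_sum_mult_right[of B d A X] B X
      mat_trace_mat_sum[of A "\<lambda>a. B * X a" d] mat_trace_mat_sum[of A "\<lambda>a. X a * B" d]
    by simp_all
qed

text \<open>Both POVMs sum to the identity, which leaves the squared norm of the state. The
  statement concerns \<open>P\<close> alone, so a realization in one dimension gives the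
  normalization needed in every other.\<close>

lemma quantum_corr_dim_sum_eq_1:
  assumes "P \<in> quantum_corr_dim A S d" and s: "s \<in> S" and t: "t \<in> S"
  shows "(\<Sum>a\<in>A. \<Sum>b\<in>A. P a b s t) = 1"
proof -
  obtain M E G where M: "M \<in> carrier_mat d d" "mat_trace (M * mat_adjoint M) = 1"
    and E: "\<forall>s\<in>S. is_povm d A (E s)" and G: "\<forall>t\<in>S. is_povm d A (G t)"
    and P: "\<forall>a\<in>A. \<forall>b\<in>A. \<forall>s\<in>S. \<forall>t\<in>S.
       complex_of_real (P a b s t) = mat_trace (E s a * (M * (G t b * mat_adjoint M)))"
    using assms(1) unfolding quantum_corr_dim_iff_mat by blast
  have M': "mat_adjoint M \<in> carrier_mat d d" using M(1) by simp
  have Ec: "E s a \<in> carrier_mat d d" and Gc: "G t a \<in> carrier_mat d d" if "a \<in> A" for a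
    using that E G s t by (auto simp: is_povm_iff psd_mat_def)
  have GM: "G t b * mat_adjoint M \<in> carrier_mat d d" if "b \<in> A" for b
    by (rule mult_carrier_mat[OF Gc[OF that] M'])
  have H: "M * (G t b * mat_adjoint M) \<in> carrier_mat d d" if "b \<in> A" for b
    by (rule mult_carrier_mat[OF M(1) GM[OF that]])
  have MM: "M * mat_adjoint M \<in> carrier_mat d d" by (rule mult_carrier_mat[OF M(1) M'])
  have sumH: "mat_sum d A (\<lambda>b. M * (G t b * mat_adjoint M)) = M * mat_adjoint M"
    using G t M' mat_sum_mult_left[OF M(1), of A "\<lambda>b. G t b * mat_adjoint M"] GM
      mat_sum_mult_right[OF M', of A "G t"] Gc
    by (simp add: is_povm_iff left_mult_one_mat[OF M'])
  have "complex_of_real (\<Sum>a\<in>A. \<Sum>b\<in>A. P a b s t)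
      = (\<Sum>a\<in>A. \<Sum>b\<in>A. mat_trace (E s a * (M * (G t b * mat_adjoint M))))"
    using P s t by simp
  also have "\<dots> = (\<Sum>a\<in>A. mat_trace (E s a * (M * mat_adjoint M)))"
  proof (rule sum.cong[OF refl])
    fix a assume a: "a \<in> A"
    show "(\<Sum>b\<in>A. mat_trace (E s a * (M * (G t b * mat_adjoint M))))
        = mat_trace (E s a * (M * mat_adjoint M))"
      using mat_trace_mult_mat_sum(1)[OF Ec[OF a], of A "\<lambda>b. M * (G t b * mat_adjoint M)"] H sumH
      by simp
  qed
  also have "\<dots> = mat_trace (mat_sum d A (E s) * (M * mat_adjoint M))"
    by (rule mat_trace_mult_mat_sum(2)[OF MM Ec, symmetric])
  also have "\<dots> = 1" using E s M(2) by (simp add: is_povm_iff left_mult_one_mat[OF MM])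
  finally show ?thesis by (simp only: of_real_eq_1_iff)
qed

section \<open>Products and traces under unitary conjugation\<close>

lemma conj_unitary_mult:
  assumes "U \<in> carrier_mat d d" "U * mat_adjoint U = 1\<^sub>m d" "X \<in> carrier_mat d d" "Y \<in> carrier_mat d d"
  shows "(mat_adjoint U * X * U) * (mat_adjoint U * Y * U) = mat_adjoint U * (X * Y) * U"
proof -
  have "(mat_adjoint U * X * U) * (mat_adjoint U * Y * U) = mat_adjoint U * (X * ((U * mat_adjoint U) * (Y * U)))"
    using assms(1,3,4) by (simp add: assoc_mult_mat[of _ d d _ d _ d] mult_carrier_mat[of _ d d _ d])
  also have "\<dots> = mat_adjoint U * (X * Y) * U"
    using assms(1,3,4) by (simp add: assms(2) assoc_mult_mat[of _ d d _ d _ d] mult_carrier_mat[of _ d d _ d])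
  finally show ?thesis .
qed

lemma mat_trace_conj_unitary:
  fixes U :: "complex mat"
  assumes "U \<in> carrier_mat d d" "U * mat_adjoint U = 1\<^sub>m d" "X \<in> carrier_mat d d"
  shows "mat_trace (mat_adjoint U * X * U) = mat_trace X"
proof -
  have "mat_trace (mat_adjoint U * X * U) = mat_trace (U * (mat_adjoint U * X))"
    using assms by (intro mat_trace_mult_comm[of _ d d]) (auto simp: mult_carrier_mat[of _ d d _ d])
  also have "U * (mat_adjoint U * X) = (U * mat_adjoint U) * X"
    using assms(1,3) by (simp add: assoc_mult_mat[of _ d d _ d _ d])
  finally show ?thesis using assms by simp
qed

section \<open>Synchronous correlations and cpsd factorizations of equal dimension\<close>

lemma quantum_corr_dim_pos:
  assumes "P \<in> quantum_corr_dim A S d"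
  shows "0 < d"
proof (rule ccontr)
  assume "\<not> 0 < d"
  then show False using assms by (auto simp: quantum_corr_dim_def scalar_prod_def)
qed

text \<open>The computation takes place in an eigenbasis of \<open>\<rho>\<close>, where its fourth
  root is diagonal and commuting with \<open>\<rho>\<close> becomes a condition on single
  entries.\<close>

lemma synchronous_quantum_corr_imp_cpsd_factorizable:
  assumes A: "finite A" and PQ: "P \<in> quantum_corr_dim A S d" and sync: "synchronous A S P"
  shows "cpsd_factorizable (S \<times> A) (corr_matrix P) d"
proof -
  obtain M E G where M: "M \<in> carrier_mat d d"
    and E: "\<forall>s\<in>S. is_povm d A (E s)" and G: "\<forall>t\<in>S. is_povm d A (G t)"
    and P: "\<forall>a\<in>A. \<forall>b\<in>A. \<forall>s\<in>S. \<forall>t\<in>S.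
       complex_of_real (P a b s t) = mat_trace (E s a * (M * (G t b * mat_adjoint M)))"
    using PQ unfolding quantum_corr_dim_iff_mat by blast
  note sq = mult_carrier_mat[of _ d d _ d]
  note assoc = assoc_mult_mat[of _ d d _ d _ d]
  have M': "mat_adjoint M \<in> carrier_mat d d" using M by simp
  define \<rho> where "\<rho> = M * mat_adjoint M"
  have \<rho>: "psd_mat d \<rho>" using psd_mat_adjoint_mult[OF M'] by (simp add: \<rho>_def)
  note \<rho>c = psd_mat_carrier[OF \<rho>]
  define H where "H t b = M * (G t b * mat_adjoint M)" for t b
  have Ep: "psd_mat d (E s a)" and Gp: "psd_mat d (G s a)" if "s \<in> S" "a \<in> A" for s a
    using that E G by (auto simp: is_povm_iff)
  note Ec = psd_mat_carrier[OF Ep] and Gc = psd_mat_carrier[OF Gp]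
  \<comment> \<open>\<open>H s a\<close> is the congruence of \<open>G s a\<close> by the adjoint of
    \<open>M\<close>.\<close>
  have Hp: "psd_mat d (H s a)" if "s \<in> S" "a \<in> A" for s a
    using psd_mat_congruence[OF Gp[OF that] M'] assoc[OF M Gc[OF that] M'] by (simp add: H_def)
  note Hc = psd_mat_carrier[OF Hp]
  have sumH: "mat_sum d A (H s) = \<rho>" if s: "s \<in> S" for s
  proof -
    have "mat_sum d A (H s) = M * (mat_sum d A (G s) * mat_adjoint M)"
      using mat_sum_mult_left[OF M, of A "\<lambda>b. G s b * mat_adjoint M"] sq[OF Gc[OF s] M']
        mat_sum_mult_right[OF M', of A "G s"] Gc[OF s]
      by (simp add: H_def[abs_def])
    then show ?thesis using G s by (simp add: is_povm_iff \<rho>_def left_mult_one_mat[OF M'])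
  qed
  have EH: "E s a * H s b = 0\<^sub>m d d" if "s \<in> S" "a \<in> A" "b \<in> A" "a \<noteq> b" for s a b
  proof (rule psd_mat_trace_mult_eq_0)
    have "complex_of_real (P a b s s) = mat_trace (E s a * H s b)"
      using P that by (simp add: H_def)
    moreover have "P a b s s = 0" using sync that by (simp add: synchronous_def)
    ultimately show "mat_trace (E s a * H s b) = 0" by simp
  qed (use that Ep Hp in auto)
  \<comment> \<open>Expand \<open>\<rho>\<close> as the sum of the \<open>H s b\<close>; only
    \<open>b = a\<close> survives. The surviving term is then re-expanded over the first factor,
    where the \<open>E s b\<close> sum to the identity.\<close>
  have E\<rho>: "E s a * \<rho> = H s a" if s: "s \<in> S" and a: "a \<in> A" for s a
  proof -
    have "E s a * \<rho> = mat_sum d A (\<lambda>b. E s a * H s b)"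
      using mat_sum_mult_left[OF Ec[OF s a], of A "H s"] Hc[OF s] sumH[OF s] by simp
    also have "\<dots> = E s a * H s a"
      using EH[OF s a] sq[OF Ec[OF s a] Hc[OF s a]] by (intro mat_sum_singleton[OF A a]) auto
    also have "\<dots> = mat_sum d A (\<lambda>b. E s b * H s a)"
      using EH[OF s _ a] sq[OF Ec[OF s a] Hc[OF s a]]
      by (intro mat_sum_singleton[OF A a, symmetric]) auto
    also have "\<dots> = mat_sum d A (E s) * H s a"
      using mat_sum_mult_right[OF Hc[OF s a], of A "E s"] Ec[OF s] by simp
    also have "\<dots> = H s a"
      using E s by (simp add: is_povm_iff left_mult_one_mat[OF Hc[OF s a]])
    finally show ?thesis .
  qed
  have \<rho>E: "\<rho> * E s a = H s a" if "s \<in> S" "a \<in> A" for s a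
    using arg_cong[OF E\<rho>[OF that], of mat_adjoint] mat_adjoint_mult[OF Ec[OF that] \<rho>c]
    by (simp add: psd_mat_adjoint[OF \<rho>] psd_mat_adjoint[OF Ep[OF that]] psd_mat_adjoint[OF Hp[OF that]])
  obtain U r where U: "U \<in> carrier_mat d d" "mat_adjoint U * U = 1\<^sub>m d" "U * mat_adjoint U = 1\<^sub>m d"
    and r: "\<forall>i. 0 \<le> r i" and D: "mat_adjoint U * \<rho> * U = real_diag_mat d r"
    by (rule psd_mat_diagonalization[OF \<rho>])
  define N where "N s a = mat_adjoint U * E s a * U" for s a
  \<comment> \<open>Fourth roots of the eigenvalues: each of the two factors in a trace carries
    \<open>q\<close> on both sides, so four of them must multiply to one eigenvalue.\<close>
  define q where "q i = sqrt (sqrt (r i))" for i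
  define X where "X = (\<lambda>(s, a). real_diag_mat d q * (N s a * real_diag_mat d q))"
  have Np: "psd_mat d (N s a)" if "s \<in> S" "a \<in> A" for s a
    unfolding N_def by (rule psd_mat_congruence[OF Ep[OF that] U(1)])
  note Nc = psd_mat_carrier[OF Np]
  have NQ: "N s a * real_diag_mat d q \<in> carrier_mat d d" if "s \<in> S" "a \<in> A" for s a
    by (rule sq[OF Nc[OF that] real_diag_mat_carrier])
  have Xp: "psd_mat d (X (s, a))" if "s \<in> S" "a \<in> A" for s a
    using psd_mat_congruence[OF Np[OF that] real_diag_mat_carrier, of q]
      assoc[OF real_diag_mat_carrier Nc[OF that] real_diag_mat_carrier, of q q]
    by (simp add: X_def)
  have X_index: "X (s, a) $$ (i, j) = q i * N s a $$ (i, j) * q j"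
    if "s \<in> S" "a \<in> A" "i < d" "j < d" for s a i j
    using that
    by (simp add: X_def index_real_diag_mult_left[OF NQ] index_real_diag_mult_right[OF Nc]
        del: index_mult_mat(1))
  have ND: "real_diag_mat d r * N s a = N s a * real_diag_mat d r" if "s \<in> S" "a \<in> A" for s a
    unfolding N_def D[symmetric]
    by (simp only: conj_unitary_mult[OF U(1,3)] \<rho>c Ec[OF that] E\<rho>[OF that] \<rho>E[OF that])
  \<comment> \<open>Commuting with a diagonal matrix forces entries between different eigenvalues to
    vanish.\<close>
  have N0: "N s a $$ (i, j) = 0 \<or> r i = r j" if "s \<in> S" "a \<in> A" "i < d" "j < d" for s a i j
    using arg_cong[OF ND[OF that(1,2)], of "\<lambda>x. x $$ (i, j)"] that
    by (simp add: index_real_diag_mult_left[OF Nc] index_real_diag_mult_right[OF Nc]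
        del: index_mult_mat(1))
  have "complex_of_real (P a b s t) = mat_trace (X (s, a) * X (t, b))"
    if sa: "s \<in> S" "a \<in> A" and tb: "t \<in> S" "b \<in> A" for s t a b
  proof -
    have NR: "N t b * real_diag_mat d r \<in> carrier_mat d d"
      by (rule sq[OF Nc[OF tb] real_diag_mat_carrier])
    have "complex_of_real (P a b s t) = mat_trace (E s a * (E t b * \<rho>))"
      using P sa tb by (simp add: E\<rho>[OF tb] H_def)
    also have "\<dots> = mat_trace (mat_adjoint U * (E s a * (E t b * \<rho>)) * U)"
      by (rule mat_trace_conj_unitary[OF U(1,3), symmetric]) (intro sq Ec sa tb \<rho>c)
    also have "mat_adjoint U * (E s a * (E t b * \<rho>)) * U = N s a * (N t b * real_diag_mat d r)"
      unfolding N_def D[symmetric]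
      by (simp only: conj_unitary_mult[OF U(1,3)] \<rho>c Ec[OF sa] Ec[OF tb] sq[OF Ec[OF tb] \<rho>c])
    also have "mat_trace \<dots> = (\<Sum>i<d. \<Sum>j<d. N s a $$ (i, j) * (N t b $$ (j, i) * r i))"
      using tb by (simp add: mat_trace_mult[OF Nc[OF sa] NR] index_real_diag_mult_right[OF Nc]
          del: index_mult_mat(1))
    also have "\<dots> = (\<Sum>i<d. \<Sum>j<d. X (s, a) $$ (i, j) * X (t, b) $$ (j, i))"
    proof (intro sum.cong refl)
      fix i j assume "i \<in> {..<d}" "j \<in> {..<d}"
      then have ij: "i < d" "j < d" by simp_all
      \<comment> \<open>By \<open>N0\<close> only pairs with \<open>r i = r j\<close> contribute,
        and for these the four roots multiply to \<open>r i\<close>.\<close>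
      have "complex_of_real (q i) * complex_of_real (q j) * (complex_of_real (q j) * complex_of_real (q i))
          = complex_of_real (r i)" if "r i = r j"
      proof -
        have "q i * q j * (q j * q i) = r i" using that r by (simp add: q_def)
        then show ?thesis by (metis of_real_mult)
      qed
      then show "N s a $$ (i, j) * (N t b $$ (j, i) * r i) = X (s, a) $$ (i, j) * X (t, b) $$ (j, i)"
        using N0[OF sa ij] by (auto simp: X_index sa tb ij mult_ac)
    qed
    also have "\<dots> = mat_trace (X (s, a) * X (t, b))"
      using mat_trace_mult[OF psd_mat_carrier[OF Xp[OF sa]] psd_mat_carrier[OF Xp[OF tb]]] by simp
    finally show ?thesis .
  qed
  then show ?thesis
    unfolding cpsd_factorizable_def using quantum_corr_dim_pos[OF PQ] Xp
    by (auto simp: corr_matrix_def intro!: exI[of _ X])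
qed

text \<open>\<open>sum1\<close> supplies the normalization, which a cpsd factorization alone does
  not carry. The measurements are built in an eigenbasis of the common sum, where pseudo-inverse and
  kernel projection are diagonal.\<close>

lemma cpsd_factorizable_imp_quantum_corr_dim:
  assumes A: "finite A" and cpsd: "cpsd_factorizable (S \<times> A) (corr_matrix P) d"
    and sum1: "\<And>s t. s \<in> S \<Longrightarrow> t \<in> S \<Longrightarrow> (\<Sum>a\<in>A. \<Sum>b\<in>A. P a b s t) = 1"
  shows "P \<in> quantum_corr_dim A S d"
proof (cases "S = {}")
  case True
  have d: "0 < d" using cpsd by (simp add: cpsd_factorizable_def)
  \<comment> \<open>Without questions any unit state will do; the scaled identity is one because
    \<open>d\<close> is positive.\<close>
  define M where "M = real_diag_mat d (\<lambda>_. 1 / sqrt (real d))"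
  have "real d * (1 / sqrt (real d) * (1 / sqrt (real d))) = 1"
    using d by simp
  from arg_cong[OF this, of complex_of_real] have "mat_trace (M * mat_adjoint M) = 1"
    using d by (simp add: M_def real_diag_mat_mult mat_trace_def)
  moreover have "M \<in> carrier_mat d d" by (simp add: M_def)
  ultimately show ?thesis
    unfolding quantum_corr_dim_iff_mat True by blast
next
  case False
  then obtain s0 where s0: "s0 \<in> S" by blast
  obtain X where X: "\<forall>i\<in>S \<times> A. psd_mat d (X i)"
    and PX: "\<forall>i\<in>S \<times> A. \<forall>j\<in>S \<times> A. complex_of_real (corr_matrix P i j) = mat_trace (X i * X j)"
    using cpsd unfolding cpsd_factorizable_def by blast
  note sq = mult_carrier_mat[of _ d d _ d]
  have Xp: "psd_mat d (X (s, a))" if "s \<in> S" "a \<in> A" for s a using X that by blast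
  note Xc = psd_mat_carrier[OF Xp]
  have P: "complex_of_real (P a b s t) = mat_trace (X (s, a) * X (t, b))"
    if "s \<in> S" "a \<in> A" "t \<in> S" "b \<in> A" for s t a b
    using PX that by (auto simp: corr_matrix_def)
  define Y where "Y s = mat_sum d A (\<lambda>a. X (s, a))" for s
  have Yp: "psd_mat d (Y s)" if "s \<in> S" for s
    unfolding Y_def using A Xp that by (intro psd_mat_mat_sum) auto
  note Yc = psd_mat_carrier[OF Yp]
  have YY: "mat_trace (Y s * Y t) = 1" if s: "s \<in> S" and t: "t \<in> S" for s t
  proof -
    have "mat_trace (Y s * Y t) = (\<Sum>a\<in>A. mat_trace (X (s, a) * Y t))"
      using mat_trace_mult_mat_sum(2)[OF Yc[OF t], of A "\<lambda>a. X (s, a)"] Xc[OF s]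
      by (simp add: Y_def[of s])
    also have "\<dots> = (\<Sum>a\<in>A. \<Sum>b\<in>A. mat_trace (X (s, a) * X (t, b)))"
    proof (rule sum.cong[OF refl])
      fix a assume a: "a \<in> A"
      show "mat_trace (X (s, a) * Y t) = (\<Sum>b\<in>A. mat_trace (X (s, a) * X (t, b)))"
        using mat_trace_mult_mat_sum(1)[OF Xc[OF s a], of A "\<lambda>b. X (t, b)"] Xc[OF t]
        by (simp add: Y_def)
    qed
    also have "\<dots> = complex_of_real (\<Sum>a\<in>A. \<Sum>b\<in>A. P a b s t)"
      using s t by (simp add: P)
    finally show ?thesis using sum1[OF s t] by simp
  qed
  \<comment> \<open>The difference \<open>Z\<close> is Hermitian, so its squared Frobenius norm is
    the trace of its square. This expands into four traces, each equal to 1, with cancelling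
    signs.\<close>
  have Y_eq: "Y s = Y s0" if s: "s \<in> S" for s
  proof (rule eq_matI)
    define Z where "Z = mat d d (\<lambda>(i, j). Y s $$ (i, j) - Y s0 $$ (i, j))"
    have Z: "Z \<in> carrier_mat d d" by (simp add: Z_def)
    have Z_index: "Z $$ (i, j) = Y s $$ (i, j) - Y s0 $$ (i, j)" if "i < d" "j < d" for i j
      using that by (simp add: Z_def)
    have "mat_adjoint Z = Z"
    proof (rule eq_matI)
      fix i j assume "i < dim_row Z" "j < dim_col Z"
      then have ij: "i < d" "j < d" using Z by simp_all
      then show "mat_adjoint Z $$ (i, j) = Z $$ (i, j)"
        using Z psd_mat_index_conjugate[OF Yp[OF s] ij] psd_mat_index_conjugate[OF Yp[OF s0] ij]
        by (simp add: Z_def)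
    qed (use Z in auto)
    then have "mat_trace (mat_adjoint Z * Z) = mat_trace (Z * Z)" by simp
    also have "\<dots> = (\<Sum>i<d. \<Sum>j<d. Y s $$ (i, j) * Y s $$ (j, i) - Y s $$ (i, j) * Y s0 $$ (j, i)
        - (Y s0 $$ (i, j) * Y s $$ (j, i) - Y s0 $$ (i, j) * Y s0 $$ (j, i)))"
      by (simp add: mat_trace_mult[OF Z Z] Z_index algebra_simps)
    also have "\<dots> = mat_trace (Y s * Y s) - mat_trace (Y s * Y s0)
        - (mat_trace (Y s0 * Y s) - mat_trace (Y s0 * Y s0))"
      using s s0 by (simp add: mat_trace_mult[OF Yc Yc] sum_subtractf)
    also have "\<dots> = 0" using s s0 by (simp add: YY)
    finally have "Z = 0\<^sub>m d d" by (rule mat_trace_adjoint_mult_eq_0[OF Z])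
    fix i j assume "i < dim_row (Y s0)" "j < dim_col (Y s0)"
    then have ij: "i < d" "j < d" using Yc[OF s0] by simp_all
    then have "Z $$ (i, j) = 0" by (simp add: \<open>Z = 0\<^sub>m d d\<close>)
    then show "Y s $$ (i, j) = Y s0 $$ (i, j)" using ij by (simp add: Z_def)
  qed (use Yc[OF s] Yc[OF s0] in auto)
  obtain U r where U: "U \<in> carrier_mat d d" "mat_adjoint U * U = 1\<^sub>m d" "U * mat_adjoint U = 1\<^sub>m d"
    and r: "\<forall>i. 0 \<le> r i" and D: "mat_adjoint U * Y s0 * U = real_diag_mat d r"
    by (rule psd_mat_diagonalization[OF Yp[OF s0]])
  define N where "N s a = mat_adjoint U * X (s, a) * U" for s a
  have Np: "psd_mat d (N s a)" if "s \<in> S" "a \<in> A" for s a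
    unfolding N_def by (rule psd_mat_congruence[OF Xp[OF that] U(1)])
  note Nc = psd_mat_carrier[OF Np]
  have sumN: "mat_sum d A (N s) = real_diag_mat d r" if s: "s \<in> S" for s
  proof -
    have U': "mat_adjoint U \<in> carrier_mat d d" using U(1) by simp
    show ?thesis
      unfolding D[symmetric] Y_eq[OF s, symmetric]
      using mat_sum_mult_right[OF U(1), of A "\<lambda>a. mat_adjoint U * X (s, a)"] sq[OF U' Xc[OF s]]
        mat_sum_mult_left[OF U', of A "\<lambda>a. X (s, a)"] Xc[OF s]
      by (simp add: N_def[abs_def] Y_def)
  qed
  have sumN_index: "(\<Sum>a\<in>A. N s a $$ (i, j)) = (if i = j then complex_of_real (r i) else 0)"
    if "s \<in> S" "i < d" "j < d" for s i j
    using arg_cong[OF sumN[OF that(1)], of "\<lambda>x. x $$ (i, j)"] that by simp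
  \<comment> \<open>The nonnegative diagonal entries at \<open>i\<close> sum to
    \<open>r i = 0\<close>, so each vanishes and takes its row and column along.\<close>
  have N0: "N s a $$ (i, j) = 0" "N s a $$ (j, i) = 0"
    if sa: "s \<in> S" "a \<in> A" and ij: "i < d" "j < d" and ri: "r i = 0" for s a i j
  proof -
    have pos: "0 \<le> Re (N s b $$ (i, i))" "Im (N s b $$ (i, i)) = 0" if "b \<in> A" for b
      using psd_mat_index_diag_ge_0[OF Np[OF sa(1) that] ij(1)] by (auto simp: less_eq_complex_def)
    have "(\<Sum>b\<in>A. Re (N s b $$ (i, i))) = 0"
      using arg_cong[OF sumN_index[OF sa(1) ij(1,1)], of Re] ri by simp
    then have "Re (N s a $$ (i, i)) = 0"
      using A sa(2) pos(1) by (simp add: sum_nonneg_eq_0_iff)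
    then have "N s a $$ (i, i) = 0" using pos(2)[OF sa(2)] by (simp add: complex_eq_iff)
    from psd_mat_index_eq_0[OF Np[OF sa] this ij]
    show "N s a $$ (i, j) = 0" "N s a $$ (j, i) = 0" .
  qed
  \<comment> \<open>For empty \<open>A\<close> the total probability would be 0 instead of
    1.\<close>
  have cardA: "card A \<noteq> 0"
    using sum1[OF s0 s0] A by auto
  text \<open>Junk value: \<open>c i = 0\<close> where \<open>r i = 0\<close>, so \<open>c\<close> is the pseudo-inverse of \<open>sqrt r\<close>.\<close>
  define c where "c i = 1 / sqrt (r i)" for i
  \<comment> \<open>The kernel of the state is shared equally among the outcomes, completing the sum
    of the \<open>E s a\<close> to the identity.\<close>
  define k where "k i = (if r i = 0 then 1 / real (card A) else 0)" for i
  define E where "E s a = real_diag_mat d c * N s a * real_diag_mat d c + real_diag_mat d k" for s a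
  have Ep: "psd_mat d (E s a)" if "s \<in> S" "a \<in> A" for s a
    unfolding E_def
    using psd_mat_congruence[OF Np[OF that] real_diag_mat_carrier, of c]
    by (intro psd_mat_add psd_mat_real_diag_mat) (auto simp: k_def)
  note Ec = psd_mat_carrier[OF Ep]
  have E_index: "E s a $$ (i, j) = c i * N s a $$ (i, j) * c j + (if i = j then k i else 0)"
    if "s \<in> S" "a \<in> A" "i < d" "j < d" for s a i j
  proof -
    have CN: "real_diag_mat d c * N s a \<in> carrier_mat d d"
      by (rule sq[OF real_diag_mat_carrier Nc[OF that(1,2)]])
    then show ?thesis
      using that sq[OF CN real_diag_mat_carrier]
      by (simp add: E_def index_real_diag_mult_right[OF CN] index_real_diag_mult_left[OF Nc]
          del: index_mult_mat(1))
  qed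
  have povm: "is_povm d A (E s)" if s: "s \<in> S" for s
    unfolding is_povm_iff
  proof (intro conjI ballI)
    show "mat_sum d A (E s) = 1\<^sub>m d"
    proof (rule eq_matI)
      fix i j assume "i < dim_row (1\<^sub>m d :: complex mat)" "j < dim_col (1\<^sub>m d :: complex mat)"
      then have ij: "i < d" "j < d" by simp_all
      have "mat_sum d A (E s) $$ (i, j)
          = c i * (\<Sum>a\<in>A. N s a $$ (i, j)) * c j + card A * (if i = j then k i else 0)"
        using ij s by (simp add: E_index sum.distrib sum_distrib_left sum_distrib_right)
      also have "\<dots> = (if i = j then complex_of_real (c i * r i * c i + card A * k i) else 0)"
        by (simp add: sumN_index[OF s ij])
      also have "c i * r i * c i + card A * k i = 1"
        using r cardA by (simp add: c_def k_def)
      finally show "mat_sum d A (E s) $$ (i, j) = 1\<^sub>m d $$ (i, j)" using ij by simp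
    qed auto
  qed (use Ep s in auto)
  \<comment> \<open>The diagonal matrix of \<open>r\<close> is \<open>Y s0\<close> in its eigenbasis
    and serves as the state; \<open>YY\<close> makes it a unit vector.\<close>
  have "mat_trace (real_diag_mat d r * mat_adjoint (real_diag_mat d r)) = mat_trace (Y s0 * Y s0)"
    using conj_unitary_mult[OF U(1,3) Yc[OF s0] Yc[OF s0]]
      mat_trace_conj_unitary[OF U(1,3) sq[OF Yc[OF s0] Yc[OF s0]]]
    by (simp add: D)
  then have norm: "mat_trace (real_diag_mat d r * mat_adjoint (real_diag_mat d r)) = 1"
    using YY[OF s0 s0] by simp
  have "complex_of_real (P a b s t) = mat_trace (E s a * (real_diag_mat d r *
      (E t b * mat_adjoint (real_diag_mat d r))))"
    if sa: "s \<in> S" "a \<in> A" and tb: "t \<in> S" "b \<in> A" for s t a b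
  proof -
    have ED: "E t b * real_diag_mat d r \<in> carrier_mat d d"
      by (rule sq[OF Ec[OF tb] real_diag_mat_carrier])
    have "complex_of_real (P a b s t) = mat_trace (N s a * N t b)"
      using P[OF sa tb] conj_unitary_mult[OF U(1,3) Xc[OF sa] Xc[OF tb]]
        mat_trace_conj_unitary[OF U(1,3) sq[OF Xc[OF sa] Xc[OF tb]]]
      by (simp add: N_def)
    also have "\<dots> = (\<Sum>i<d. \<Sum>j<d. N s a $$ (i, j) * N t b $$ (j, i))"
      by (rule mat_trace_mult[OF Nc[OF sa] Nc[OF tb]])
    also have "\<dots> = (\<Sum>i<d. \<Sum>j<d. E s a $$ (i, j) * (r j * (E t b $$ (j, i) * r i)))"
    proof (intro sum.cong refl)
      fix i j assume "i \<in> {..<d}" "j \<in> {..<d}"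
      then have ij: "i < d" "j < d" by simp_all
      show "N s a $$ (i, j) * N t b $$ (j, i) = E s a $$ (i, j) * (r j * (E t b $$ (j, i) * r i))"
      \<comment> \<open>On the kernel both sides vanish, the left by \<open>N0\<close> and the right
        by a factor from the state. Elsewhere \<open>k\<close> is 0 and the factors \<open>c\<close>
        cancel \<open>r i * r j\<close>.\<close>
      proof (cases "r i = 0 \<or> r j = 0")
        case True
        then show ?thesis using N0[OF sa ij] N0[OF sa ij(2,1)] by auto
      next
        case False
        then have k0: "k i = 0" "k j = 0" by (simp_all add: k_def)
        have "c i * c j * (c j * c i) * (r i * r j) = 1"
          using False r by (simp add: c_def field_simps)
        then have *: "complex_of_real (c i) * c j * (c j * c i) * (complex_of_real (r i) * r j) = 1"
          by (metis of_real_1 of_real_mult)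
        have "E s a $$ (i, j) * (r j * (E t b $$ (j, i) * r i)) =
            (complex_of_real (c i) * c j * (c j * c i) * (complex_of_real (r i) * r j))
              * (N s a $$ (i, j) * N t b $$ (j, i))"
          using k0 by (simp add: E_index sa tb ij mult_ac)
        then show ?thesis by (simp only: * mult_1)
      qed
    qed
    also have "\<dots> = mat_trace (E s a * (real_diag_mat d r * (E t b * real_diag_mat d r)))"
      using tb
      by (simp add: mat_trace_mult[OF Ec[OF sa] sq[OF real_diag_mat_carrier ED]]
          index_real_diag_mult_left[OF ED] index_real_diag_mult_right[OF Ec] del: index_mult_mat(1))
    finally show ?thesis by simp
  qed
  then have "\<forall>a\<in>A. \<forall>b\<in>A. \<forall>s\<in>S. \<forall>t\<in>S. complex_of_real (P a b s t) =
      mat_trace (E s a * (real_diag_mat d r * (E t b * mat_adjoint (real_diag_mat d r))))"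
    by blast
  then show ?thesis
    unfolding quantum_corr_dim_iff_mat using norm povm
    \<comment> \<open>The same family \<open>E\<close> serves both parties, as the matrix form has
      absorbed the transposition.\<close>
    by (intro exI[of _ "real_diag_mat d r"] exI[of _ E] conjI ballI) auto
qed

theorem propositionA1:
  fixes A :: "'a set" and S :: "'s set"
    and P :: "'a \<Rightarrow> 'a \<Rightarrow> 's \<Rightarrow> 's \<Rightarrow> real"
  assumes "finite A" and "finite S"
    and "P \<in> quantum_corr A S"
    and "synchronous A S P"
  shows "completely_psd (S \<times> A) (corr_matrix P) \<and>
         (LEAST d. P \<in> quantum_corr_dim A S d) = cpsd_rank (S \<times> A) (corr_matrix P)"
proof -
  obtain d0 where d0: "P \<in> quantum_corr_dim A S d0"
    using assms(3) by (auto simp: quantum_corr_def)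
  \<comment> \<open>Both minima are \<open>LEAST\<close> of predicates that agree at every
    \<open>d\<close>. The realization in dimension \<open>d0\<close> provides the total
    probabilities and a witness that a factorization exists.\<close>
  have "P \<in> quantum_corr_dim A S d \<longleftrightarrow> cpsd_factorizable (S \<times> A) (corr_matrix P) d" for d
    using synchronous_quantum_corr_imp_cpsd_factorizable[OF assms(1) _ assms(4)]
      cpsd_factorizable_imp_quantum_corr_dim[of A S P d, OF assms(1) _ quantum_corr_dim_sum_eq_1[OF d0]]
    by blast
  then show ?thesis
    using d0 by (auto simp: completely_psd_def cpsd_rank_def)
qed

end
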